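(* Let $f:\mathbb{R}^n\to\mathbb{R}$ be $C^1$, let $\mathbf{x}_0\in\mathbb{R}^n$, and consider Algorithm 2 (defined in the context) run on $f$ from $\mathbf{x}_0$ with exact line search. Let $k\ge1$ be such that iterations $1,\dots,k$ are carried out (so $\mathbf{p}_1,\dots,\mathbf{p}_k$ are nonzero). Put $$H_{k+1}=l_1\circ\cdots\circ l_k\circ l_k^T\circ\cdots\circ l_1^T,\qquad \mathbf{y}_k=\nabla f(\mathbf{x}_k)-\nabla f(\mathbf{x}_{k-1}).$$ Then the secant condition $$H_{k+1}\mathbf{y}_k=\mathbf{m}_k$$ holds.
   Context: Algorithm 2 (for a differentiable $f:\mathbb{R}^n\to\mathbb{R}$ and starting point $\mathbf{x}_0$). For $k=1,2,\dots$, as long as $\mathbf{p}_k\neq 0$: - $\mathbf{p}_k:=-l_{k-1}^T\circ\cdots\circ l_1^T(\nabla f(\mathbf{x}_{k-1}))$; - $\mathbf{m}_k:=l_1\circ\cdots\circ l_{k-1}(\mathbf{p}_k)$; - $\alpha_k:=\operatorname{argmin}\{f(\mathbf{x}_{k-1}+\alpha\mathbf{m}_k):\alpha\ge 0\}$ (exact line search: a minimizer is assumed to exist and $\alpha_k$ is such a minimizer); - $\mathbf{x}_k:=\mathbf{x}_{k-1}+\alpha_k\mathbf{m}_k$; - $\mathbf{g}_k:=-l_{k-1}^T\circ\cdots\circ l_1^T(\nabla f(\mathbf{x}_k))$; - $l_k:\mathbb{R}^n\to\mathbb{R}^n$ is the linear map $l_k(\mathbf{x})=\left(I+\mathbf{p}_k\mathbf{g}_k^T/\|\mathbf{p}_k\|^2\right)\mathbf{x}$,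 and $l_k^T$ is its transpose. Empty compositions (for $k=1$) are the identity; $I$ is the $n\times n$ identity matrix and $\|\cdot\|$ is the Euclidean norm. *)

theory Defs
  imports "HOL-Analysis.Analysis"
begin

definition grad :: "(real^'n \<Rightarrow> real) \<Rightarrow> real^'n \<Rightarrow> real^'n" where
  "grad f x = (THE D. GDERIV f x :> D)"

definition C1 :: "(real^'n \<Rightarrow> real) \<Rightarrow> bool" where
  "C1 f \<longleftrightarrow> (\<forall>x. f differentiable (at x)) \<and> continuous_on UNIV (grad f)"

definition lmap :: "real^'n \<Rightarrow> real^'n \<Rightarrow> real^'n \<Rightarrow> real^'n" where
  "lmap p g = (\<lambda>x. (mat 1 + (1 / (norm p)\<^sup>2) *\<^sub>R
     ((columnvector p :: real^1^'n) ** (rowvector g :: real^'n^1))) *v x)"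

definition transpose_map :: "(real^'n \<Rightarrow> real^'n) \<Rightarrow> real^'n \<Rightarrow> real^'n" where
  "transpose_map l = (\<lambda>x. transpose (matrix l) *v x)"

text \<open>\<open>comp_maps l k\<close> is \<open>l 1 \<circ> \<dots> \<circ> l k\<close>, and \<open>comp_transposes l k\<close> is
  \<open>(l k)\<^sup>T \<circ> \<dots> \<circ> (l 1)\<^sup>T\<close>. The sequences are indexed from 1; \<open>l 0\<close> is never used.\<close>

primrec comp_maps :: "(nat \<Rightarrow> real^'n \<Rightarrow> real^'n) \<Rightarrow> nat \<Rightarrow> real^'n \<Rightarrow> real^'n" where
  "comp_maps l 0 = id"
| "comp_maps l (Suc k) = comp_maps l k \<circ> l (Suc k)"

primrec comp_transposes :: "(nat \<Rightarrow> real^'n \<Rightarrow> real^'n) \<Rightarrow> nat \<Rightarrow> real^'n \<Rightarrow> real^'n" where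
  "comp_transposes l 0 = id"
| "comp_transposes l (Suc k) = transpose_map (l (Suc k)) \<circ> comp_transposes l k"

text \<open>The sequences record a run from \<open>x0\<close> in which iterations \<open>1, \<dots>, N\<close> are all carried
  out. The step length \<open>\<alpha> k\<close> may be any minimizer of the line search, so a run is a relation
  rather than a function of \<open>f\<close> and \<open>x0\<close>. Entries beyond \<open>N\<close> are unconstrained.\<close>

definition algorithm2_run ::
  "(real^'n \<Rightarrow> real) \<Rightarrow> real^'n \<Rightarrow> nat \<Rightarrow> (nat \<Rightarrow> real^'n) \<Rightarrow> (nat \<Rightarrow> real^'n) \<Rightarrow> (nat \<Rightarrow> real^'n) \<Rightarrow>
   (nat \<Rightarrow> real) \<Rightarrow> (nat \<Rightarrow> real^'n) \<Rightarrow> (nat \<Rightarrow> real^'n \<Rightarrow> real^'n) \<Rightarrow> bool" where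
  "algorithm2_run f x0 N x p m \<alpha> g l \<longleftrightarrow>
     x 0 = x0 \<and>
     (\<forall>k\<in>{1..N}.
        p k = - comp_transposes l (k - 1) (grad f (x (k - 1))) \<and>
        p k \<noteq> 0 \<and>
        m k = comp_maps l (k - 1) (p k) \<and>
        is_arg_min (\<lambda>a. f (x (k - 1) + a *\<^sub>R m k)) (\<lambda>a. a \<ge> 0) (\<alpha> k) \<and>
        x k = x (k - 1) + \<alpha> k *\<^sub>R m k \<and>
        g k = - comp_transposes l (k - 1) (grad f (x k)) \<and>
        l k = lmap (p k) (g k))"

text \<open>\<open>H_op l j\<close> is \<open>l 1 \<circ> \<dots> \<circ> l (j-1) \<circ> (l (j-1))\<^sup>T \<circ> \<dots> \<circ> (l 1)\<^sup>T\<close> for \<open>j \<ge> 1\<close>.\<close>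

definition H_op :: "(nat \<Rightarrow> real^'n \<Rightarrow> real^'n) \<Rightarrow> nat \<Rightarrow> real^'n \<Rightarrow> real^'n" where
  "H_op l j = comp_maps l (j - 1) \<circ> comp_transposes l (j - 1)"

end

theory Submission
  imports Defs
begin

text \<open>Write \<open>L\<close> for the composition of the transposes of \<open>l 1, \<dots>, l (k - 1)\<close>. Since \<open>L\<close> is
  linear, it sends the gradient difference to \<open>p - g\<close>, where \<open>p = p k\<close> and \<open>g = g k\<close>, and the
  adjoint of \<open>L\<close> sends \<open>p\<close> to \<open>m k\<close>. It therefore suffices that \<open>l k \<circ> (l k)\<^sup>T\<close> maps
  \<open>p - g\<close> to \<open>p\<close>. For the rank-one update this holds as soon as \<open>p \<bullet> g = 0\<close>:
  then \<open>(l k)\<^sup>T\<close> replaces \<open>p - g\<close> by \<open>p\<close>, and \<open>l k\<close> fixes \<open>p\<close>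
  (\<open>lmap_transpose_secant\<close>).

  The orthogonality \<open>p \<bullet> g = 0\<close> is exactness of the line search: by adjointness
  (\<open>comp_maps_adjoint\<close>), \<open>p \<bullet> g\<close> is minus the slope of \<open>f\<close> along \<open>m k\<close> at \<open>x k\<close>. That slope
  vanishes when the minimizing step is positive. A zero step cannot occur, because by the same
  adjointness the slope at the starting point is \<open>-(norm p)\<^sup>2 < 0\<close>.\<close>

lemma gderiv_grad:
  fixes f :: "real^'n \<Rightarrow> real"
  assumes "f differentiable (at x)"
  shows "GDERIV f x :> grad f x"
proof -
  obtain f' where f': "(f has_derivative f') (at x)"
    using assms by (auto simp: differentiable_def)
  have lin: "linear f'"
    using f' by (rule has_derivative_linear)
  \<comment> \<open>The Riesz representative of a functional is its adjoint applied to \<open>1\<close>.\<close>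
  have "f' = (\<lambda>h. h \<bullet> adjoint f' 1)"
    by (simp add: fun_eq_iff adjoint_works[OF lin])
  then have ex: "GDERIV f x :> adjoint f' 1"
    using f' unfolding gderiv_def by metis
  have uniq: "D = E" if "GDERIV f x :> D" "GDERIV f x :> E" for D E
  proof -
    have "(\<lambda>h. h \<bullet> D) = (\<lambda>h. h \<bullet> E)"
      using that unfolding gderiv_def by (rule has_derivative_unique)
    then show ?thesis
      by (simp add: fun_eq_iff vector_eq_ldot)
  qed
  show ?thesis
    unfolding grad_def by (rule theI[where P = "\<lambda>D. GDERIV f x :> D", OF ex uniq[OF _ ex]])
qed

lemma has_real_derivative_along_line:
  fixes f :: "real^'n \<Rightarrow> real"
  assumes "f differentiable (at (y + a *\<^sub>R d))"
  shows "((\<lambda>t. f (y + t *\<^sub>R d)) has_real_derivative (d \<bullet> grad f (y + a *\<^sub>R d))) (at a)"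
proof -
  have "(f has_derivative (\<lambda>h. h \<bullet> grad f (y + a *\<^sub>R d))) (at (y + a *\<^sub>R d))"
    using gderiv_grad[OF assms] by (simp add: gderiv_def)
  moreover have "((\<lambda>t. y + t *\<^sub>R d) has_derivative (\<lambda>t. t *\<^sub>R d)) (at a)"
    by (auto intro!: derivative_eq_intros)
  ultimately have "((\<lambda>t. f (y + t *\<^sub>R d)) has_derivative
      (\<lambda>t. (t *\<^sub>R d) \<bullet> grad f (y + a *\<^sub>R d))) (at a)"
    by (rule has_derivative_compose[rotated])
  then show ?thesis
    by (simp add: has_field_derivative_def mult_commute_abs)
qed

lemma derivative_at_halfline_minimizer:
  fixes h :: "real \<Rightarrow> real"
  assumes min: "is_arg_min h (\<lambda>a. a \<ge> 0) b"
    and D: "(h has_real_derivative D) (at b)"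
  shows "0 \<le> D" and "0 < b \<Longrightarrow> D = 0"
proof -
  have b: "0 \<le> b" and le: "h b \<le> h a" if "0 \<le> a" for a
    using min that by (auto simp: is_arg_min_linorder)
  show "0 \<le> D"
  proof (rule ccontr)
    assume "\<not> 0 \<le> D"
    then obtain e where "e > 0" "\<And>t. 0 < t \<Longrightarrow> t < e \<Longrightarrow> h (b + t) < h b"
      using DERIV_neg_dec_right[OF D] by auto
    then have "h (b + e / 2) < h b"
      by simp
    with le[of "b + e / 2"] b[of 0] \<open>e > 0\<close> show False
      by simp
  qed
  show "D = 0" if "0 < b"
  proof (rule DERIV_local_min[OF D that])
    show "\<forall>y. \<bar>b - y\<bar> < b \<longrightarrow> h b \<le> h y"
      using le by auto
  qed
qed

lemma lmap_apply: "lmap p g z = z + ((g \<bullet> z) / (norm p)\<^sup>2) *\<^sub>R p"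
proof -
  have "((columnvector p :: real^1^_) ** (rowvector g :: real^_^1)) *v z = (g \<bullet> z) *\<^sub>R p"
    by (simp add: vec_eq_iff matrix_vector_mult_def matrix_matrix_mult_def columnvector_def
        rowvector_def inner_vec_def sum_distrib_left mult_ac)
  then show ?thesis
    by (simp add: lmap_def matrix_vector_mult_add_rdistrib scaleR_matrix_vector_assoc[symmetric])
qed

lemma linear_lmap: "linear (lmap p g)"
  by (simp add: lmap_def)

lemma inner_transpose_map:
  assumes "linear l"
  shows "transpose_map l a \<bullet> b = a \<bullet> l b"
  by (simp add: transpose_map_def dot_lmul_matrix matrix_works
      assms linear_matrix_vector_mul_eq)

lemma transpose_map_lmap: "transpose_map (lmap p g) z = z + ((p \<bullet> z) / (norm p)\<^sup>2) *\<^sub>R g"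
proof (rule iffD1[OF vector_eq_rdot], rule allI)
  fix w
  show "transpose_map (lmap p g) z \<bullet> w = (z + ((p \<bullet> z) / (norm p)\<^sup>2) *\<^sub>R g) \<bullet> w"
    unfolding inner_transpose_map[OF linear_lmap] lmap_apply
    by (simp add: inner_add_left inner_add_right inner_commute)
qed

text \<open>Under orthogonality, \<open>l\<^sup>T\<close> removes the \<open>g\<close> component: it fixes \<open>g\<close> and sends
  \<open>p\<close> to \<open>p + g\<close>.\<close>

lemma lmap_transpose_secant:
  assumes "p \<noteq> 0" "p \<bullet> g = 0"
  shows "lmap p g (transpose_map (lmap p g) (p - g)) = p"
proof -
  have "transpose_map (lmap p g) (p - g) = p"
    using assms by (simp add: transpose_map_lmap inner_diff_right power2_norm_eq_inner)
  then show ?thesis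
    using assms by (simp add: lmap_apply inner_commute)
qed

lemma linear_comp_transposes: "linear (comp_transposes l j)"
proof (induction j)
  case (Suc j)
  have "linear (transpose_map (l (Suc j)))"
    unfolding transpose_map_def by (rule matrix_vector_mul_linear)
  with Suc show ?case
    by (simp only: comp_transposes.simps linear_compose)
qed (simp only: comp_transposes.simps linear_id)

lemma comp_maps_adjoint:
  assumes "\<And>i. i \<in> {1..j} \<Longrightarrow> linear (l i)"
  shows "comp_transposes l j a \<bullet> b = a \<bullet> comp_maps l j b"
  using assms by (induction j arbitrary: b) (simp_all add: inner_transpose_map)

theorem mainTheorem2:
  fixes f :: "real^'n \<Rightarrow> real" and x0 :: "real^'n" and k :: nat
    and x p m g :: "nat \<Rightarrow> real^'n" and \<alpha> :: "nat \<Rightarrow> real"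
    and l :: "nat \<Rightarrow> real^'n \<Rightarrow> real^'n"
  assumes "C1 f"
    and "k \<ge> 1"
    and "algorithm2_run f x0 k x p m \<alpha> g l"
  shows "H_op l (k + 1) (grad f (x k) - grad f (x (k - 1))) = m k"
proof -
  obtain j where k: "k = Suc j"
    using \<open>k \<ge> 1\<close> by (cases k) auto
  let ?L = "comp_transposes l j"
  have diff: "f differentiable (at z)" for z
    using \<open>C1 f\<close> by (simp add: C1_def)
  have run: "l i = lmap (p i) (g i)" if "i \<in> {1..k}" for i
    using assms(3) that by (simp add: algorithm2_run_def)
  have p: "p k = - ?L (grad f (x j))" "p k \<noteq> 0"
    and m: "m k = comp_maps l j (p k)"
    and min: "is_arg_min (\<lambda>a. f (x j + a *\<^sub>R m k)) (\<lambda>a. a \<ge> 0) (\<alpha> k)"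
    and x: "x k = x j + \<alpha> k *\<^sub>R m k"
    and g: "g k = - ?L (grad f (x k))"
    using assms(3) \<open>k \<ge> 1\<close> k unfolding algorithm2_run_def
    by (metis atLeastAtMost_iff order_refl diff_Suc_1)+
  have adj: "?L a \<bullet> p k = a \<bullet> m k" for a
    unfolding m by (rule comp_maps_adjoint) (simp add: run k linear_lmap)

  let ?D = "m k \<bullet> grad f (x k)"
  have deriv: "((\<lambda>a. f (x j + a *\<^sub>R m k)) has_real_derivative ?D) (at (\<alpha> k))"
    unfolding x by (rule has_real_derivative_along_line[OF diff])
  have "0 < \<alpha> k"
  proof (rule ccontr)
    assume "\<not> 0 < \<alpha> k"
    moreover have "0 \<le> \<alpha> k"
      using min by (simp add: is_arg_min_def)
    ultimately have "x k = x j"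
      using x by simp
    then have "?D = - (p k \<bullet> p k)"
      using adj[of "grad f (x j)"] p(1) by (simp add: inner_commute)
    also have "\<dots> < 0"
      using p(2) by simp
    finally show False
      using derivative_at_halfline_minimizer(1)[OF min deriv] by simp
  qed
  then have "?D = 0"
    by (rule derivative_at_halfline_minimizer(2)[OF min deriv])
  then have orth: "p k \<bullet> g k = 0"
    using adj[of "grad f (x k)"] by (simp add: g inner_commute)

  have "?L (grad f (x k) - grad f (x j)) = p k - g k"
    by (simp add: linear_diff[OF linear_comp_transposes] p(1) g)
  then have "H_op l (k + 1) (grad f (x k) - grad f (x j))
      = comp_maps l j (l k (transpose_map (l k) (p k - g k)))"
    by (simp add: H_op_def k)
  also have "\<dots> = m k"
    using lmap_transpose_secant[OF p(2) orth] run[of k] \<open>k \<ge> 1\<close> by (simp add: m)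
  finally show ?thesis
    by (simp add: k)
qed

end
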